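(* Let $d\ge1$ and let $\lambda$ be a complete signed tail family, viewed as a function on $P_d^\times$. Then its witness weights $w$ (the unique solution of $\lambda=Aw$) are the Möbius transform of $\lambda$: $$w(x)=\sum_{y\succeq x}\mu(x,y)\,\lambda(y),\qquad x\in P_d^\times,$$ where $\mu$ is the Möbius function of $P_d^\times$. Equivalently, for every $(I,\sigma)\in\mathcal G_d$, $$w_{I,\sigma}=\sum_{K\supseteq I}\ \sum_{\rho\in\{\mathrm L,\mathrm U\}^K:\,\rho|_I=\sigma}(-1)^{|K|-|I|}\lambda_{K,\rho}.$$
   Context: $[d]=\{1,\dots,d\}$. Let $E=\{\mathrm M,\mathrm L,\mathrm U\}$ with the partial order $\mathrm M\prec\mathrm L$, $\mathrm M\prec\mathrm U$, and $\mathrm L,\mathrm U$ incomparable. $P_d=E^d$ carries the product order $\preceq$, and $P_d^\times=P_d\setminus\{(\mathrm M,\dots,\mathrm M)\}$ the induced order. $\mathcal G_d=\{(I,\sigma):\emptyset\ne I\subseteq[d],\ \sigma\in\{\mathrm L,\mathrm U\}^I\}$, where $\{\mathrm L,\mathrm U\}^I$ is the set of functions $I\to\{\mathrm L,\mathrm U\}$. The bijection $\mathcal G_d\to P_d^\times$ sends $(I,\sigma)$ to the $x$ with $x_i=\sigma_i$ for $i\in I$ and $x_i=\mathrm M$ for $i\notin I$; families indexed by $\mathcal G_d$ are viewed as functions on $P_d^\times$ through it. A complete signed tail family is a real family $(\lambda_{J,\tau})_{(J,\tau)\in\mathcal G_d}$. The witness incidence matrix is $A_{(J,\tau),(I,\sigma)}=\mathbf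 1\{J\subseteq I,\ \sigma|_J=\tau\}$, and $w=(w_{I,\sigma})$ is the real system with $\lambda=Aw$ (it exists and is unique; $w$ is also given by the recursion, by descending $|I|$, $w_{I,\sigma}=\lambda_{I,\sigma}-\sum_{K\supsetneq I}\sum_{\rho:\rho|_I=\sigma}w_{K,\rho}$). *)

theory Defs
  imports Complex_Main "HOL-Library.FuncSet"
begin

datatype tail = M | L | U

instantiation tail :: order
begin

definition less_eq_tail :: "tail \<Rightarrow> tail \<Rightarrow> bool"
  where "less_eq_tail a b \<longleftrightarrow> a = M \<or> a = b"

definition less_tail :: "tail \<Rightarrow> tail \<Rightarrow> bool"
  where "less_tail a b \<longleftrightarrow> a = M \<and> b \<noteq> M"

instance
  by standard (auto simp: less_eq_tail_def less_tail_def)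

end

text \<open>
  Points are extensional functions on \<open>{1..d}\<close>. All of them take the value \<open>undefined\<close>
  outside \<open>{1..d}\<close>, so the pointwise order of the function type, restricted to
  \<open>points d\<close>, is the product order.
\<close>

definition points :: "nat \<Rightarrow> (nat \<Rightarrow> tail) set"
  where "points d = {1..d} \<rightarrow>\<^sub>E UNIV"

definition proper_points :: "nat \<Rightarrow> (nat \<Rightarrow> tail) set"
  where "proper_points d = points d - {\<lambda>i\<in>{1..d}. M}"

definition signed_sets :: "nat \<Rightarrow> (nat set \<times> (nat \<Rightarrow> tail)) set"
  where "signed_sets d = {(I, \<sigma>). I \<noteq> {} \<and> I \<subseteq> {1..d} \<and> \<sigma> \<in> I \<rightarrow>\<^sub>E {L, U}}"

definition to_point :: "nat \<Rightarrow> nat set \<times> (nat \<Rightarrow> tail) \<Rightarrow> nat \<Rightarrow> tail"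
  where "to_point d = (\<lambda>(I, \<sigma>). \<lambda>i\<in>{1..d}. if i \<in> I then \<sigma> i else M)"

lemma bij_betw_to_point: "bij_betw (to_point d) (signed_sets d) (proper_points d)"
proof -
  let ?g = "\<lambda>x. ({i\<in>{1..d}. x i \<noteq> M}, restrict x {i\<in>{1..d}. x i \<noteq> M})"
  have 1: "\<forall>a\<in>signed_sets d. ?g (to_point d a) = a"
  proof (rule ballI, unfold split_paired_all)
    fix I \<sigma> assume "(I, \<sigma>) \<in> signed_sets d"
    then have I: "I \<subseteq> {1..d}" and s: "\<sigma> \<in> I \<rightarrow>\<^sub>E {L, U}"
      by (auto simp: signed_sets_def)
    have ne: "\<sigma> i \<noteq> M" if "i \<in> I" for i
      using s that by (force dest: PiE_mem)
    have eq: "{i\<in>{1..d}. to_point d (I, \<sigma>) i \<noteq> M} = I"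
      using I ne by (auto simp: to_point_def)
    have "restrict (to_point d (I, \<sigma>)) I = \<sigma>"
    proof
      fix i show "restrict (to_point d (I, \<sigma>)) I i = \<sigma> i"
        using I PiE_arb[OF s, of i] by (auto simp: to_point_def restrict_def)
    qed
    with eq show "?g (to_point d (I, \<sigma>)) = (I, \<sigma>)" by simp
  qed
  have 2: "\<forall>x\<in>proper_points d. to_point d (?g x) = x"
    by (fastforce simp: proper_points_def points_def to_point_def restrict_def PiE_def
        extensional_def)
  have 3: "to_point d ` signed_sets d \<subseteq> proper_points d"
  proof (rule image_subsetI, unfold split_paired_all)
    fix I \<sigma> assume "(I, \<sigma>) \<in> signed_sets d"
    then have I: "I \<subseteq> {1..d}" "I \<noteq> {}" and s: "\<sigma> \<in> I \<rightarrow>\<^sub>E {L, U}"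
      by (auto simp: signed_sets_def)
    from I obtain i where i: "i \<in> I" "i \<in> {1..d}" by blast
    then have "\<sigma> i \<noteq> M" using PiE_mem[OF s, of i] by auto
    with i have "to_point d (I, \<sigma>) i \<noteq> (\<lambda>i\<in>{1..d}. M) i"
      by (simp add: to_point_def)
    then have "to_point d (I, \<sigma>) \<noteq> (\<lambda>i\<in>{1..d}. M)" by metis
    then show "to_point d (I, \<sigma>) \<in> proper_points d"
      by (auto simp: proper_points_def points_def to_point_def)
  qed
  have 4: "?g ` proper_points d \<subseteq> signed_sets d"
  proof (rule image_subsetI)
    fix x assume x: "x \<in> proper_points d"
    have "\<exists>i\<in>{1..d}. x i \<noteq> M"
    proof (rule ccontr)
      assume "\<not> (\<exists>i\<in>{1..d}. x i \<noteq> M)"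
      then have "x = (\<lambda>i\<in>{1..d}. M)"
        using x by (auto simp: proper_points_def points_def PiE_def extensional_def fun_eq_iff)
      with x show False by (simp add: proper_points_def)
    qed
    moreover have "x i \<in> {L, U}" if "x i \<noteq> M" for i
      using that by (cases "x i") auto
    ultimately show "?g x \<in> signed_sets d"
      by (auto simp: signed_sets_def)
  qed
  show ?thesis
    using 1 2 3 4 by (rule bij_betw_byWitness)
qed

text \<open>A family indexed by \<open>signed_sets d\<close>, viewed as a function on \<open>proper_points d\<close>.\<close>

definition on_points :: "nat \<Rightarrow> (nat set \<times> (nat \<Rightarrow> tail) \<Rightarrow> real) \<Rightarrow> (nat \<Rightarrow> tail) \<Rightarrow> real"
  where "on_points d f x = f (the_inv_into (signed_sets d) (to_point d) x)"

definition incidence :: "nat set \<times> (nat \<Rightarrow> tail) \<Rightarrow> nat set \<times> (nat \<Rightarrow> tail) \<Rightarrow> real"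
  where "incidence = (\<lambda>(J, \<tau>) (I, \<sigma>). if J \<subseteq> I \<and> restrict \<sigma> J = \<tau> then 1 else 0)"

text \<open>
  The system \<open>\<lambda> = A w\<close>. Families that agree on \<open>signed_sets d\<close> are identified by
  requiring \<open>w\<close> to be extensional, so that uniqueness is equality of functions.
\<close>

definition solves_witness_system ::
    "nat \<Rightarrow> (nat set \<times> (nat \<Rightarrow> tail) \<Rightarrow> real) \<Rightarrow> (nat set \<times> (nat \<Rightarrow> tail) \<Rightarrow> real) \<Rightarrow> bool"
  where "solves_witness_system d lam w \<longleftrightarrow>
    w \<in> extensional (signed_sets d) \<and>
    (\<forall>g\<in>signed_sets d. lam g = (\<Sum>h\<in>signed_sets d. incidence g h * w h))"

definition witness_weights ::
    "nat \<Rightarrow> (nat set \<times> (nat \<Rightarrow> tail) \<Rightarrow> real) \<Rightarrow> nat set \<times> (nat \<Rightarrow> tail) \<Rightarrow> real"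
  where "witness_weights d lam = (THE w. solves_witness_system d lam w)"

text \<open>
  The Moebius function of a locally finite poset \<open>S\<close> with the induced order. The value is \<open>0\<close>
  unless \<open>x \<le> y\<close>; the finiteness guard is there only for termination.
\<close>

function moebius :: "'a::order set \<Rightarrow> 'a \<Rightarrow> 'a \<Rightarrow> int" where
  "moebius S x y =
    (if x \<in> S \<and> y \<in> S \<and> x \<le> y \<and> finite {z\<in>S. x \<le> z \<and> z \<le> y}
     then if x = y then 1 else - (\<Sum>z\<in>{z\<in>S. x \<le> z \<and> z < y}. moebius S x z)
     else 0)"
  by pat_completeness auto
termination
proof (relation "measure (\<lambda>(S, x, y). card {z\<in>S. x \<le> z \<and> z \<le> y})")
  fix S :: "'a set" and x y z
  assume xy: "x \<in> S \<and> y \<in> S \<and> x \<le> y \<and> finite {z\<in>S. x \<le> z \<and> z \<le> y}"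
    and z: "z \<in> {z\<in>S. x \<le> z \<and> z < y}"
  have "{u\<in>S. x \<le> u \<and> u \<le> z} \<subseteq> {u\<in>S. x \<le> u \<and> u \<le> y}"
    using z by auto
  moreover have "y \<in> {u\<in>S. x \<le> u \<and> u \<le> y} - {u\<in>S. x \<le> u \<and> u \<le> z}"
    using xy z by auto
  ultimately have "{u\<in>S. x \<le> u \<and> u \<le> z} \<subset> {u\<in>S. x \<le> u \<and> u \<le> y}"
    by blast
  with xy show "((S, x, z), (S, x, y)) \<in> measure (\<lambda>(S, x, y). card {z\<in>S. x \<le> z \<and> z \<le> y})"
    by (auto intro: psubset_card_mono)
qed auto

declare moebius.simps [simp del]

end

theory Submission
  imports Defs
begin

text \<open>
  The witness incidence matrix \<open>A\<close> is the zeta matrix of the poset of signed sets, ordered by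
  extension, and this order is the one induced from the proper points. So \<open>\<lambda> = A w\<close> says that
  \<open>\<lambda>\<close> arises from \<open>w\<close> by summing over principal up-sets, and the first formula for \<open>w\<close> is
  Moebius inversion: the recursion for \<open>\<mu>\<close> makes it a left inverse of the zeta matrix
  (\<open>moebius_inversion\<close>).

  The signed formula comes from an explicit inverse. Below a signed set \<open>(K, \<rho>)\<close> there is exactly
  one signed set for each nonempty \<open>J \<subseteq> K\<close>, namely the restriction of \<open>\<rho>\<close> to \<open>J\<close>. Hence
  every interval is a Boolean lattice, in which the signs \<open>(-1)\<^bsup>|J|\<^esup>\<close> cancel
  unless it is a single element. In matrix form this is \<open>A D A = D\<close>, with \<open>D\<close> the diagonal matrix of these signs
  (\<open>incidence_sign_incidence\<close>). As \<open>D\<close> is an involution, \<open>A\<close> is invertible with inverse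
  \<open>D A D\<close>, which gives existence, uniqueness and the formula at once.
\<close>

section \<open>Moebius inversion over up-sets\<close>

lemma sum_moebius_interval:
  assumes "finite S" "x \<in> S" "y \<in> S" "x \<le> y"
  shows "(\<Sum>z\<in>{z\<in>S. x \<le> z \<and> z \<le> y}. moebius S x z) = (if x = y then 1 else 0)"
proof (cases "x = y")
  case True
  then have "{z\<in>S. x \<le> z \<and> z \<le> y} = {x}"
    using assms by auto
  moreover have "moebius S y y = 1"
    using assms by (subst moebius.simps) simp
  ultimately show ?thesis
    using True by simp
next
  case False
  have "{z\<in>S. x \<le> z \<and> z \<le> y} = insert y {z\<in>S. x \<le> z \<and> z < y}"
    using assms by auto
  then show ?thesis
    using False assms by (simp add: moebius.simps[of S x y])
qed

text \<open>
  Exchanging the two summations collects, for each \<open>z\<close>, the sum of \<open>\<mu>(x, y)\<close> over the interval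
  from \<open>x\<close> to \<open>z\<close> as the coefficient of \<open>w z\<close>; only \<open>z = x\<close> survives.
\<close>

lemma moebius_inversion:
  fixes f w :: "'a::order \<Rightarrow> 'b::comm_ring_1"
  assumes fin: "finite S" and x: "x \<in> S"
    and f: "\<And>y. y \<in> S \<Longrightarrow> f y = (\<Sum>z\<in>{z\<in>S. y \<le> z}. w z)"
  shows "w x = (\<Sum>y\<in>{y\<in>S. x \<le> y}. of_int (moebius S x y) * f y)"
proof -
  have "(\<Sum>y\<in>{y\<in>S. x \<le> y}. of_int (moebius S x y) * f y)
      = (\<Sum>y\<in>{y\<in>S. x \<le> y}. \<Sum>z\<in>{z\<in>S. y \<le> z}. of_int (moebius S x y) * w z)"
    by (intro sum.cong) (auto simp: f sum_distrib_left)
  also have "\<dots> = (\<Sum>y\<in>{y\<in>S. x \<le> y}. \<Sum>z\<in>{z\<in>{z\<in>S. x \<le> z}. y \<le> z}.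
      of_int (moebius S x y) * w z)"
    by (intro sum.cong refl) auto
  also have "\<dots> = (\<Sum>z\<in>{z\<in>S. x \<le> z}. \<Sum>y\<in>{y\<in>{y\<in>S. x \<le> y}. y \<le> z}.
      of_int (moebius S x y) * w z)"
    by (rule sum.swap_restrict) (use fin in auto)
  also have "\<dots> = (\<Sum>z\<in>{z\<in>S. x \<le> z}. of_int (\<Sum>y\<in>{y\<in>S. x \<le> y \<and> y \<le> z}. moebius S x y) * w z)"
    by (simp add: sum_distrib_right conj_assoc)
  also have "\<dots> = (\<Sum>z\<in>{z\<in>S. x \<le> z}. if x = z then w z else 0)"
    by (intro sum.cong refl) (simp add: sum_moebius_interval[OF fin x])
  also have "\<dots> = w x"
    using fin x by simp
  finally show ?thesis ..
qed

section \<open>Signed sets as a poset\<close>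

lemma finite_signed_sets: "finite (signed_sets d)"
proof -
  have "signed_sets d \<subseteq> Sigma (Pow {1..d}) (\<lambda>I. I \<rightarrow>\<^sub>E {L, U})"
    by (auto simp: signed_sets_def)
  moreover have "finite (Sigma (Pow {1..d}) (\<lambda>I. I \<rightarrow>\<^sub>E {L, U}))"
    by (intro finite_SigmaI finite_PiE) (auto intro: finite_subset)
  ultimately show ?thesis
    by (rule finite_subset)
qed

lemma restrict_mem_signed_sets:
  assumes "(K, \<rho>) \<in> signed_sets d" "J \<subseteq> K" "J \<noteq> {}"
  shows "(J, restrict \<rho> J) \<in> signed_sets d"
  using assms by (fastforce simp: signed_sets_def PiE_iff)

text \<open>
  Since \<open>M\<close> is the bottom element and \<open>L\<close>, \<open>U\<close> are incomparable, lying above a point means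
  keeping its signs and possibly replacing some \<open>M\<close>; this is extension of signed sets.
\<close>

lemma incidence_eq_to_point_le:
  assumes "g \<in> signed_sets d" "h \<in> signed_sets d"
  shows "incidence g h = (if to_point d g \<le> to_point d h then 1 else 0)"
proof -
  obtain J \<tau> I \<sigma> where gh: "g = (J, \<tau>)" "h = (I, \<sigma>)"
    by (cases g, cases h)
  have J: "J \<subseteq> {1..d}" and I: "I \<subseteq> {1..d}"
    and \<tau>: "\<tau> \<in> J \<rightarrow>\<^sub>E {L, U}" and \<sigma>: "\<sigma> \<in> I \<rightarrow>\<^sub>E {L, U}"
    using assms gh by (auto simp: signed_sets_def)
  have ne: "\<tau> i \<noteq> M" if "i \<in> J" for i
    using PiE_mem[OF \<tau> that] by auto
  have "to_point d g \<le> to_point d h \<longleftrightarrow> (\<forall>i\<in>J. i \<in> I \<and> \<sigma> i = \<tau> i)"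
  proof
    assume le: "to_point d g \<le> to_point d h"
    show "\<forall>i\<in>J. i \<in> I \<and> \<sigma> i = \<tau> i"
    proof
      fix i assume i: "i \<in> J"
      then show "i \<in> I \<and> \<sigma> i = \<tau> i"
        using le_funD[OF le, of i] J ne[OF i]
        by (auto simp: gh to_point_def less_eq_tail_def split: if_splits)
    qed
  next
    assume "\<forall>i\<in>J. i \<in> I \<and> \<sigma> i = \<tau> i"
    then show "to_point d g \<le> to_point d h"
      by (auto simp: le_fun_def gh to_point_def less_eq_tail_def)
  qed
  also have "\<dots> \<longleftrightarrow> J \<subseteq> I \<and> restrict \<sigma> J = \<tau>"
    using PiE_arb[OF \<tau>] by (auto simp: fun_eq_iff restrict_def)
  finally show ?thesis
    by (simp add: incidence_def gh)
qed

lemma on_points_to_point: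
  assumes "g \<in> signed_sets d"
  shows "on_points d f (to_point d g) = f g"
  using bij_betw_to_point[of d] assms
  by (simp add: on_points_def the_inv_into_f_f bij_betw_def)

lemma sum_incidence_eq_sum_up_set:
  assumes "g \<in> signed_sets d"
  shows "(\<Sum>h\<in>signed_sets d. incidence g h * w h)
    = (\<Sum>z\<in>{z\<in>proper_points d. to_point d g \<le> z}. on_points d w z)"
proof -
  have "(\<Sum>z\<in>{z\<in>proper_points d. to_point d g \<le> z}. on_points d w z)
      = (\<Sum>z\<in>proper_points d. if to_point d g \<le> z then on_points d w z else 0)"
    using bij_betw_finite[OF bij_betw_to_point[of d]] finite_signed_sets by (simp add: sum.inter_filter)
  also have "\<dots> = (\<Sum>h\<in>signed_sets d.
      if to_point d g \<le> to_point d h then on_points d w (to_point d h) else 0)"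
    by (rule sum.reindex_bij_betw[OF bij_betw_to_point, symmetric])
  also have "\<dots> = (\<Sum>h\<in>signed_sets d. incidence g h * w h)"
    using assms by (intro sum.cong) (auto simp: on_points_to_point incidence_eq_to_point_le)
  finally show ?thesis ..
qed

section \<open>Inverting the incidence matrix by signs\<close>

lemma alternating_sum_subset_interval:
  assumes "finite K" "I \<subseteq> K"
  shows "(\<Sum>J\<in>{J. J \<subseteq> K \<and> I \<subseteq> J}. (-1) ^ card J) = (if I = K then (-1) ^ card K else 0 :: 'a::ring_1)"
proof (cases "I = K")
  case True
  then have "{J. J \<subseteq> K \<and> I \<subseteq> J} = {K}"
    by auto
  then show ?thesis
    using True by simp
next
  case False
  with assms have "I \<subset> K"
    by auto
  then have "card {J \<in> {J. J \<subseteq> K \<and> I \<subseteq> J}. even (card J)}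
      = card {J \<in> {J. J \<subseteq> K \<and> I \<subseteq> J}. odd (card J)}"
    using card_subsupersets_even_odd[OF assms(1)] by (simp add: conj_assoc)
  then show ?thesis
    using assms False sum_alternating_cancels[of "{J. J \<subseteq> K \<and> I \<subseteq> J}" card] by simp
qed

definition set_sign :: "nat set \<times> (nat \<Rightarrow> tail) \<Rightarrow> real"
  where "set_sign g = (-1) ^ card (fst g)"

lemma set_sign_mult_self: "set_sign g * set_sign g = 1"
  by (simp add: set_sign_def flip: power_mult_distrib)

text \<open>
  The signed sets between \<open>(I, \<sigma>)\<close> and an extension \<open>(K, \<rho>)\<close> are the restrictions of \<open>\<rho>\<close> to
  the sets \<open>J\<close> with \<open>I \<subseteq> J \<subseteq> K\<close>, so the entry is an alternating sum over a Boolean lattice.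
\<close>

lemma incidence_sign_incidence:
  assumes g: "g \<in> signed_sets d" and k: "k \<in> signed_sets d"
  shows "(\<Sum>h\<in>signed_sets d. incidence g h * set_sign h * incidence h k)
    = (if g = k then set_sign g else 0)"
proof -
  obtain I \<sigma> K \<rho> where gk: "g = (I, \<sigma>)" "k = (K, \<rho>)"
    by (cases g, cases k)
  have I: "I \<noteq> {}" and \<rho>: "\<rho> \<in> extensional K"
    using g k gk by (auto simp: signed_sets_def PiE_def)
  have "finite K"
    using k gk by (auto simp: signed_sets_def intro: finite_subset)
  show ?thesis
  proof (cases "I \<subseteq> K \<and> restrict \<rho> I = \<sigma>")
    case True
    let ?\<J> = "{J. J \<subseteq> K \<and> I \<subseteq> J}" and ?r = "\<lambda>J. (J, restrict \<rho> J)"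
    have "(\<Sum>h\<in>signed_sets d. incidence g h * set_sign h * incidence h k)
        = (\<Sum>h\<in>?r ` ?\<J>. incidence g h * set_sign h * incidence h k)"
    proof (rule sum.mono_neutral_right[OF finite_signed_sets])
      show "?r ` ?\<J> \<subseteq> signed_sets d"
        using I k gk by (auto intro!: restrict_mem_signed_sets)
      show "\<forall>h\<in>signed_sets d - ?r ` ?\<J>. incidence g h * set_sign h * incidence h k = 0"
      proof
        fix h assume h: "h \<in> signed_sets d - ?r ` ?\<J>"
        have "h = ?r (fst h)" if "I \<subseteq> fst h" "incidence h k \<noteq> 0"
          using that by (cases h) (auto simp: incidence_def gk split: if_splits)
        with h show "incidence g h * set_sign h * incidence h k = 0"
          by (cases h) (fastforce simp: incidence_def gk split: if_splits)
      qed
    qed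
    also have "\<dots> = (\<Sum>J\<in>?\<J>. incidence g (?r J) * set_sign (?r J) * incidence (?r J) k)"
      by (subst sum.reindex) (auto simp: inj_on_def)
    also have "\<dots> = (\<Sum>J\<in>?\<J>. (-1) ^ card J)"
      using True by (intro sum.cong refl) (simp add: incidence_def gk set_sign_def Int_absorb1)
    also have "\<dots> = (if I = K then (-1) ^ card K else 0)"
      by (rule alternating_sum_subset_interval) (use \<open>finite K\<close> True in auto)
    also have "\<dots> = (if g = k then set_sign g else 0)"
      using True extensional_restrict[OF \<rho>] by (auto simp: gk set_sign_def)
    finally show ?thesis .
  next
    case False
    then have zero: "incidence g h * set_sign h * incidence h k = 0" for h
      by (cases h) (auto simp: incidence_def gk Int_absorb1)
    have "g \<noteq> k"
      using False extensional_restrict[OF \<rho>] by (auto simp: gk)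
    then show ?thesis
      by (simp only: zero sum.neutral_const if_False)
  qed
qed

text \<open>
  Multiply \<open>f = A w\<close> by \<open>A D\<close> and use \<open>A D A = D\<close>.
\<close>

lemma sign_mult_eq_if_incidence:
  assumes f: "\<And>h. h \<in> signed_sets d \<Longrightarrow> f h = (\<Sum>k\<in>signed_sets d. incidence h k * w k)"
    and g: "g \<in> signed_sets d"
  shows "set_sign g * w g = (\<Sum>h\<in>signed_sets d. incidence g h * (set_sign h * f h))"
proof -
  have "(\<Sum>h\<in>signed_sets d. incidence g h * (set_sign h * f h))
      = (\<Sum>h\<in>signed_sets d. \<Sum>k\<in>signed_sets d.
          incidence g h * set_sign h * incidence h k * w k)"
    by (intro sum.cong refl) (simp add: f sum_distrib_left mult.assoc)
  also have "\<dots> = (\<Sum>k\<in>signed_sets d.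
      (\<Sum>h\<in>signed_sets d. incidence g h * set_sign h * incidence h k) * w k)"
    by (subst sum.swap) (simp add: sum_distrib_right)
  also have "\<dots> = (\<Sum>k\<in>signed_sets d. if g = k then set_sign k * w k else 0)"
    by (intro sum.cong refl) (simp add: incidence_sign_incidence[OF g])
  also have "\<dots> = set_sign g * w g"
    using g by (simp add: finite_signed_sets)
  finally show ?thesis ..
qed

text \<open>
  The equivalence of \<open>f = A w\<close> and \<open>w = D A D f\<close>. The right side says \<open>D w = A (D f)\<close>, which is
  the left side with \<open>D w\<close> and \<open>D f\<close> in place of \<open>f\<close> and \<open>w\<close>, so one implication gives both.
\<close>

lemma incidence_system_iff:
  "(\<forall>g\<in>signed_sets d. f g = (\<Sum>h\<in>signed_sets d. incidence g h * w h)) \<longleftrightarrow>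
   (\<forall>g\<in>signed_sets d. w g =
      set_sign g * (\<Sum>h\<in>signed_sets d. incidence g h * (set_sign h * f h)))"
  (is "?sys \<longleftrightarrow> ?sol")
proof
  have cancel: "set_sign g * (set_sign g * c) = c" for g c
    by (simp add: set_sign_mult_self flip: mult.assoc)
  show ?sol if ?sys
  proof
    fix g assume "g \<in> signed_sets d"
    from sign_mult_eq_if_incidence[OF bspec[OF that] this]
    show "w g = set_sign g * (\<Sum>h\<in>signed_sets d. incidence g h * (set_sign h * f h))"
      by (metis cancel)
  qed
  show ?sys if sol: ?sol
  proof
    fix g assume g: "g \<in> signed_sets d"
    have "set_sign h * w h = (\<Sum>k\<in>signed_sets d. incidence h k * (set_sign k * f k))"
      if "h \<in> signed_sets d" for h
      by (simp only: bspec[OF sol that] cancel)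
    from sign_mult_eq_if_incidence[OF this g]
    show "f g = (\<Sum>h\<in>signed_sets d. incidence g h * w h)"
      by (simp add: cancel)
  qed
qed

lemma ex1_solves_witness_system: "\<exists>!w. solves_witness_system d lam w"
proof
  let ?w = "restrict (\<lambda>g. set_sign g * (\<Sum>h\<in>signed_sets d. incidence g h * (set_sign h * lam h)))
    (signed_sets d)"
  show "solves_witness_system d lam ?w"
    unfolding solves_witness_system_def incidence_system_iff by simp
  show "w = ?w" if "solves_witness_system d lam w" for w
    using that unfolding solves_witness_system_def incidence_system_iff
    by (intro extensionalityI[of w "signed_sets d"]) auto
qed

lemma sum_incidence_eq_sum_extensions:
  assumes I: "I \<noteq> {}"
  shows "(\<Sum>h\<in>signed_sets d. incidence (I, \<sigma>) h * f h)
    = (\<Sum>K\<in>{K. I \<subseteq> K \<and> K \<subseteq> {1..d}}.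
        \<Sum>\<rho>\<in>{\<rho>\<in>K \<rightarrow>\<^sub>E {L, U}. restrict \<rho> I = \<sigma>}. f (K, \<rho>))"
proof -
  let ?E = "SIGMA K:{K. I \<subseteq> K \<and> K \<subseteq> {1..d}}. {\<rho>\<in>K \<rightarrow>\<^sub>E {L, U}. restrict \<rho> I = \<sigma>}"
  have "(\<Sum>h\<in>signed_sets d. incidence (I, \<sigma>) h * f h) = (\<Sum>h\<in>?E. incidence (I, \<sigma>) h * f h)"
    using I by (intro sum.mono_neutral_right finite_signed_sets)
      (auto simp: signed_sets_def incidence_def split: if_splits)
  also have "\<dots> = (\<Sum>h\<in>?E. f h)"
    by (intro sum.cong) (auto simp: incidence_def)
  also have "\<dots> = (\<Sum>K\<in>{K. I \<subseteq> K \<and> K \<subseteq> {1..d}}.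
        \<Sum>\<rho>\<in>{\<rho>\<in>K \<rightarrow>\<^sub>E {L, U}. restrict \<rho> I = \<sigma>}. f (K, \<rho>))"
  proof -
    have "finite {\<rho>\<in>K \<rightarrow>\<^sub>E {L, U}. restrict \<rho> I = \<sigma>}" if "K \<subseteq> {1..d}" for K
    proof -
      have "finite (K \<rightarrow>\<^sub>E {L, U})"
        using that by (intro finite_PiE) (auto intro: finite_subset)
      then show ?thesis
        by simp
    qed
    then show ?thesis
      by (subst sum.Sigma) auto
  qed
  finally show ?thesis .
qed

theorem corollary14:
  fixes d :: nat
    and lam :: "nat set \<times> (nat \<Rightarrow> tail) \<Rightarrow> real"
  assumes "d \<ge> 1"
  shows "(\<exists>!w. solves_witness_system d lam w) \<and>
    (\<forall>x\<in>proper_points d.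
      on_points d (witness_weights d lam) x =
        (\<Sum>y\<in>{y\<in>proper_points d. x \<le> y}.
          of_int (moebius (proper_points d) x y) * on_points d lam y)) \<and>
    (\<forall>(I, \<sigma>)\<in>signed_sets d.
      witness_weights d lam (I, \<sigma>) =
        (\<Sum>K\<in>{K. I \<subseteq> K \<and> K \<subseteq> {1..d}}.
          \<Sum>\<rho>\<in>{\<rho>\<in>K \<rightarrow>\<^sub>E {L, U}. restrict \<rho> I = \<sigma>}.
            (-1) ^ (card K - card I) * lam (K, \<rho>)))"
proof (intro conjI)
  show ex1: "\<exists>!w. solves_witness_system d lam w"
    by (rule ex1_solves_witness_system)
  define w where "w = witness_weights d lam"
  have "solves_witness_system d lam w"
    unfolding w_def witness_weights_def by (rule theI'[OF ex1])
  then have sys: "\<forall>g\<in>signed_sets d. lam g = (\<Sum>h\<in>signed_sets d. incidence g h * w h)"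
    by (simp add: solves_witness_system_def)
  show "\<forall>x\<in>proper_points d. on_points d (witness_weights d lam) x =
      (\<Sum>y\<in>{y\<in>proper_points d. x \<le> y}.
        of_int (moebius (proper_points d) x y) * on_points d lam y)"
    unfolding w_def[symmetric]
  proof
    fix x assume x: "x \<in> proper_points d"
    have fin: "finite (proper_points d)"
      using bij_betw_finite[OF bij_betw_to_point[of d]] finite_signed_sets by blast
    have up: "on_points d lam y = (\<Sum>z\<in>{z\<in>proper_points d. y \<le> z}. on_points d w z)"
      if y: "y \<in> proper_points d" for y
    proof -
      obtain g where "g \<in> signed_sets d" "y = to_point d g"
        using y bij_betw_imp_surj_on[OF bij_betw_to_point[of d]] by blast
      then show ?thesis
        using sys by (simp add: on_points_to_point sum_incidence_eq_sum_up_set)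
    qed
    show "on_points d w x = (\<Sum>y\<in>{y\<in>proper_points d. x \<le> y}.
        of_int (moebius (proper_points d) x y) * on_points d lam y)"
      by (rule moebius_inversion[OF fin x up])
  qed
  show "\<forall>(I, \<sigma>)\<in>signed_sets d. witness_weights d lam (I, \<sigma>) =
      (\<Sum>K\<in>{K. I \<subseteq> K \<and> K \<subseteq> {1..d}}.
        \<Sum>\<rho>\<in>{\<rho>\<in>K \<rightarrow>\<^sub>E {L, U}. restrict \<rho> I = \<sigma>}.
          (-1) ^ (card K - card I) * lam (K, \<rho>))"
    unfolding w_def[symmetric]
  proof (rule ballI, unfold split_paired_all prod.case)
    fix I \<sigma> assume g: "(I, \<sigma>) \<in> signed_sets d"
    then have I: "I \<noteq> {}"
      by (simp add: signed_sets_def)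
    have sign: "(-1) ^ card I * ((-1) ^ card K * c) = (-1) ^ (card K - card I) * c"
      if "I \<subseteq> K" "K \<subseteq> {1..d}" for K and c :: real
    proof -
      have "card I \<le> card K"
        using that by (meson card_mono finite_atLeastAtMost finite_subset)
      then show ?thesis
        by (simp add: minus_one_power_iff)
    qed
    have "w (I, \<sigma>) = set_sign (I, \<sigma>) *
        (\<Sum>h\<in>signed_sets d. incidence (I, \<sigma>) h * (set_sign h * lam h))"
      using sys g unfolding incidence_system_iff by blast
    also have "\<dots> = (\<Sum>K\<in>{K. I \<subseteq> K \<and> K \<subseteq> {1..d}}.
        \<Sum>\<rho>\<in>{\<rho>\<in>K \<rightarrow>\<^sub>E {L, U}. restrict \<rho> I = \<sigma>}.
          (-1) ^ card I * ((-1) ^ card K * lam (K, \<rho>)))"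
      by (simp add: sum_incidence_eq_sum_extensions[OF I] set_sign_def sum_distrib_left)
    also have "\<dots> = (\<Sum>K\<in>{K. I \<subseteq> K \<and> K \<subseteq> {1..d}}.
        \<Sum>\<rho>\<in>{\<rho>\<in>K \<rightarrow>\<^sub>E {L, U}. restrict \<rho> I = \<sigma>}.
          (-1) ^ (card K - card I) * lam (K, \<rho>))"
      by (intro sum.cong refl) (auto simp: sign)
    finally show "w (I, \<sigma>) = (\<Sum>K\<in>{K. I \<subseteq> K \<and> K \<subseteq> {1..d}}.
        \<Sum>\<rho>\<in>{\<rho>\<in>K \<rightarrow>\<^sub>E {L, U}. restrict \<rho> I = \<sigma>}.
          (-1) ^ (card K - card I) * lam (K, \<rho>))" .
  qed
qed

end
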